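(* Let $a,b,c,c_1,c_2\in\mathbb{R}$ with $b>0$, let $z=z(u)$ be a smooth real function of $u>0$, and let $M^2_{(a,b,c,c_1,c_2)}$ be the parabolic revolution surface $$\mathbf{P}(u,t)=\Big(at+u,\;bt,\;ct+\tfrac{ac_1+bc_2}{2}t^2+c_1ut+z(u)\Big),\qquad u>0,\ t\in\mathbb{R},$$ in simply isotropic space, with generating curve $\alpha(u)=(u,0,z(u))$ and parabolic Gauss map $\mathbf{G}=(G^1,G^2,G^3)$. Suppose that the top-view projection of $\mathbf{G}$ is of coordinate finite-type with $\lambda_1=\lambda_2=0$, i.e. $\Delta G^1=0$ and $\Delta G^2=0$. If, in addition, the third coordinate $G^3$ is a non-zero eigenfunction, i.e. $G^3\not\equiv0$ and $-\Delta G^3=\lambda_3G^3$ for some $\lambda_3\in\mathbb{R}$, then $\lambda_3=0$, $(a,b,c,c_1,c_2)=(a,b,c,0,0)$ (that is, $c_1=c_2=0$), and $z(u)=z_0+z_1u$ for some constants $z_0,z_1$.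
   Context: Simply isotropic space $\mathbb{I}^3$ is $\mathbb{R}^3$ with the degenerate inner product $\langle X,Y\rangle=x_1y_1+x_2y_2$. For an admissible surface $\mathbf{x}(u^1,u^2)$ (one whose induced metric $g_{ij}=\langle\partial_i\mathbf{x},\partial_j\mathbf{x}\rangle$ has rank 2), write $(\mathbf{x}_1\times\mathbf{x}_2)/X_{12}=(N^1,N^2,1)$, where $\times$ is the Euclidean cross product and $X_{12}$ is the third coordinate of $\mathbf{x}_1\times\mathbf{x}_2$. The parabolic normal (parabolic Gauss map) is $\mathbf{G}=\big(N^1,N^2,\tfrac12-\tfrac12[(N^1)^2+(N^2)^2]\big)$, and its top-view projection is $(G^1,G^2)$. $\Delta$ is the Laplace-Beltrami operator of $g_{ij}$. For the parabolic revolution surface $\mathbf{P}$, $$G^1=-c_1t-z',\qquad G^2=\frac{az'-c-bc_2t-c_1u}{b},\qquad G^3=\tfrac12-\tfrac12\big[(G^1)^2+(G^2)^2\big],$$ $$\Delta=\frac{a^2+b^2}{b^2}\frac{\partial^2}{\partial u^2}-\frac{2a}{b^2}\frac{\partial^2}{\partial u\,\partial t}+\frac1{b^2}\frac{\partial^2}{\partial t^2}.$$ *)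

theory Defs
  imports "HOL-Analysis.Analysis"
begin

unbundle cross3_syntax

(* Meant for open S, where differentiability within S and at each point of S agree. *)
definition smooth_on :: "real set \<Rightarrow> (real \<Rightarrow> real) \<Rightarrow> bool" where
  "smooth_on S f \<longleftrightarrow> (\<forall>n. (deriv ^^ n) f differentiable_on S)"

definition partial :: "2 \<Rightarrow> (real^2 \<Rightarrow> 'a::real_normed_vector) \<Rightarrow> real^2 \<Rightarrow> 'a" where
  "partial i f p = vector_derivative (\<lambda>s. f (p + s *\<^sub>R axis i 1)) (at 0)"

text \<open>Simply isotropic space is the type \<^typ>\<open>real^3\<close> with the degenerate inner product below;
  a parametrized surface is a map from the parameters \<open>(p $ 1, p $ 2) = (u\<^sup>1, u\<^sup>2)\<close>.\<close>

definition iso_inner :: "real^3 \<Rightarrow> real^3 \<Rightarrow> real" where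
  "iso_inner X Y = X $ 1 * Y $ 1 + X $ 2 * Y $ 2"

definition induced_metric :: "(real^2 \<Rightarrow> real^3) \<Rightarrow> real^2 \<Rightarrow> real^2^2" where
  "induced_metric x p = (\<chi> i j. iso_inner (partial i x p) (partial j x p))"

definition admissible_on :: "(real^2) set \<Rightarrow> (real^2 \<Rightarrow> real^3) \<Rightarrow> bool" where
  "admissible_on D x \<longleftrightarrow> (\<forall>p\<in>D. rank (induced_metric x p) = 2)"

definition laplace_beltrami ::
  "(real^2 \<Rightarrow> real^3) \<Rightarrow> (real^2 \<Rightarrow> real) \<Rightarrow> real^2 \<Rightarrow> real" where
  "laplace_beltrami x f p =
    (\<Sum>i\<in>UNIV. \<Sum>j\<in>UNIV.
      partial i (\<lambda>q. sqrt (det (induced_metric x q)) * matrix_inv (induced_metric x q) $ i $ j * partial j f q) p)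
    / sqrt (det (induced_metric x p))"

text \<open>The field \<open>N = (\<partial>\<^sub>1x \<times> \<partial>\<^sub>2x) / X\<^sub>1\<^sub>2\<close>, whose third coordinate is \<open>1\<close> where \<open>x\<close> is admissible.\<close>

definition iso_normal :: "(real^2 \<Rightarrow> real^3) \<Rightarrow> real^2 \<Rightarrow> real^3" where
  "iso_normal x p =
    (1 / (partial 1 x p \<times> partial 2 x p) $ 3) *\<^sub>R (partial 1 x p \<times> partial 2 x p)"

definition parabolic_gauss_map :: "(real^2 \<Rightarrow> real^3) \<Rightarrow> real^2 \<Rightarrow> real^3" where
  "parabolic_gauss_map x p = (let N = iso_normal x p in
    vector [N $ 1, N $ 2, 1/2 - 1/2 * ((N $ 1)\<^sup>2 + (N $ 2)\<^sup>2)])"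

text \<open>The eigenvalue equation \<open>-\<Delta>f = k f\<close>; \<open>f = 0\<close> is not excluded.\<close>

definition eigen_eq_on ::
  "(real^2) set \<Rightarrow> (real^2 \<Rightarrow> real^3) \<Rightarrow> (real^2 \<Rightarrow> real) \<Rightarrow> real \<Rightarrow> bool" where
  "eigen_eq_on D x f k \<longleftrightarrow> (\<forall>p\<in>D. - laplace_beltrami x f p = k * f p)"

definition top_view_finite_type ::
  "(real^2) set \<Rightarrow> (real^2 \<Rightarrow> real^3) \<Rightarrow> real \<Rightarrow> real \<Rightarrow> bool" where
  "top_view_finite_type D x k1 k2 \<longleftrightarrow>
    eigen_eq_on D x (\<lambda>p. parabolic_gauss_map x p $ 1) k1 \<and>
    eigen_eq_on D x (\<lambda>p. parabolic_gauss_map x p $ 2) k2"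

definition par_rev_surface ::
  "real \<Rightarrow> real \<Rightarrow> real \<Rightarrow> real \<Rightarrow> real \<Rightarrow> (real \<Rightarrow> real) \<Rightarrow> real^2 \<Rightarrow> real^3" where
  "par_rev_surface a b c c1 c2 z p = (let u = p $ 1; t = p $ 2 in
    vector [a * t + u, b * t,
            c * t + (a * c1 + b * c2) / 2 * t\<^sup>2 + c1 * u * t + z u])"

definition par_rev_domain :: "(real^2) set" where
  "par_rev_domain = {p. p $ 1 > 0}"

lemma par_rev_generating_curve:
  "par_rev_surface a b c c1 c2 z (vector [u, 0]) = vector [u, 0, z u]"
  by (simp add: par_rev_surface_def)

lemma vector3_eq_sum:
  "(vector [x, y, z] :: real^3) = x *\<^sub>R axis 1 1 + y *\<^sub>R axis 2 1 + z *\<^sub>R axis 3 1"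
  by (simp add: vec_eq_iff forall_3 axis_def)

lemma has_vector_derivative_vector3:
  assumes "(f has_real_derivative f') (at s)" "(g has_real_derivative g') (at s)"
    "(h has_real_derivative h') (at s)"
  shows "((\<lambda>s. vector [f s, g s, h s] :: real^3) has_vector_derivative vector [f', g', h']) (at s)"
  unfolding vector3_eq_sum
  by (auto intro!: derivative_eq_intros assms)

lemma smooth_on_deriv:
  assumes "smooth_on S f" "open S" "u \<in> S"
  shows "(f has_real_derivative deriv f u) (at u)"
proof -
  have "f differentiable_on S"
    using assms(1)[unfolded smooth_on_def, rule_format, of 0] by simp
  then show ?thesis
    using assms(2,3) by (simp add: DERIV_deriv_iff_real_differentiable differentiable_on_eq_differentiable_at)
qed

lemma partial_par_rev_surface:
  assumes "smooth_on {0<..} z" "p \<in> par_rev_domain"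
  shows "partial 1 (par_rev_surface a b c c1 c2 z) p = vector [1, 0, c1 * p $ 2 + deriv z (p $ 1)]"
    and "partial 2 (par_rev_surface a b c c1 c2 z) p =
           vector [a, b, c + (a * c1 + b * c2) * p $ 2 + c1 * p $ 1]"
proof -
  have dz: "(z has_real_derivative deriv z (p $ 1)) (at (p $ 1 + 0))"
    using smooth_on_deriv[OF assms(1), of "p $ 1"] assms(2) by (simp add: par_rev_domain_def)
  have dz': "((\<lambda>s. z (p $ 1 + s)) has_real_derivative deriv z (p $ 1)) (at 0)"
    using dz by (simp add: DERIV_shift[of z _ 0 "p $ 1", symmetric] add.commute)
  show "partial 1 (par_rev_surface a b c c1 c2 z) p = vector [1, 0, c1 * p $ 2 + deriv z (p $ 1)]"
    unfolding partial_def par_rev_surface_def Let_def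
    by (rule vector_derivative_at, rule has_vector_derivative_vector3)
       (auto simp: axis_def intro!: derivative_eq_intros dz')
  show "partial 2 (par_rev_surface a b c c1 c2 z) p =
           vector [a, b, c + (a * c1 + b * c2) * p $ 2 + c1 * p $ 1]"
    unfolding partial_def par_rev_surface_def Let_def
    by (rule vector_derivative_at, rule has_vector_derivative_vector3)
       (auto simp: axis_def field_simps intro!: derivative_eq_intros)
qed

lemma metric_par_rev_surface:
  assumes "smooth_on {0<..} z" "p \<in> par_rev_domain"
  shows "induced_metric (par_rev_surface a b c c1 c2 z) p = vector [vector [1, a], vector [a, a\<^sup>2 + b\<^sup>2]]"
  by (simp add: induced_metric_def iso_inner_def vec_eq_iff forall_2 partial_par_rev_surface[OF assms]
      power2_eq_square)

lemma admissible_par_rev_surface: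
  assumes "smooth_on {0<..} z" "b > 0"
  shows "admissible_on par_rev_domain (par_rev_surface a b c c1 c2 z)"
proof -
  have "rank (induced_metric (par_rev_surface a b c c1 c2 z) p) = 2" if "p \<in> par_rev_domain" for p
  proof -
    have "det (induced_metric (par_rev_surface a b c c1 c2 z) p) \<noteq> 0"
      using assms(2) by (simp add: metric_par_rev_surface[OF assms(1) that] det_2 power2_eq_square)
    then have "rank (induced_metric (par_rev_surface a b c c1 c2 z) p) = CARD(2)"
      by (simp only: det_eq_0_rank less_rank_noninjective full_rank_injective not_not)
    then show ?thesis by simp
  qed
  then show ?thesis by (simp add: admissible_on_def)
qed

lemma parabolic_gauss_map_par_rev_surface:
  assumes "smooth_on {0<..} z" "b > 0" "p \<in> par_rev_domain"
  shows "parabolic_gauss_map (par_rev_surface a b c c1 c2 z) p =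
    (let u = p $ 1; t = p $ 2;
         G1 = - c1 * t - deriv z u;
         G2 = (a * deriv z u - c - b * c2 * t - c1 * u) / b
     in vector [G1, G2, 1/2 - 1/2 * (G1\<^sup>2 + G2\<^sup>2)])"
proof -
  have "iso_normal (par_rev_surface a b c c1 c2 z) p $ 1 = - c1 * p $ 2 - deriv z (p $ 1)"
    "iso_normal (par_rev_surface a b c c1 c2 z) p $ 2 =
      (a * deriv z (p $ 1) - c - b * c2 * p $ 2 - c1 * p $ 1) / b"
    using assms(2)
    by (simp_all add: iso_normal_def partial_par_rev_surface[OF assms(1,3)] cross3_def field_simps)
  then show ?thesis by (simp add: parabolic_gauss_map_def Let_def)
qed

unbundle no cross3_syntax

end

theory Submission
  imports Defs
begin

text \<open>The induced metric of the surface is the constant, positive definite matrix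
  \<open>((1, a), (a, a\<^sup>2 + b\<^sup>2))\<close>, so \<open>\<Delta>\<close> has constant coefficients.  As \<open>G\<^sup>1 = - c\<^sub>1 t - z'(u)\<close>,
  harmonicity of \<open>G\<^sup>1\<close> amounts to \<open>z''' = 0\<close> (lemma \<open>third_derivative_zero\<close>); hence \<open>z'\<close> is affine,
  and so are \<open>G\<^sup>1\<close> and \<open>G\<^sup>2\<close> as functions of \<open>(u, t)\<close>.

  For harmonic \<open>G\<^sup>1\<close> and \<open>G\<^sup>2\<close>, the product rule turns \<open>- \<Delta>G\<^sup>3\<close> into
  \<open>E = |grad G\<^sup>1|\<^sup>2 + |grad G\<^sup>2|\<^sup>2\<close>, the gradients being taken in the induced metric; for affine
  functions \<open>E\<close> is a constant (lemma \<open>laplace_beltrami_affine_squares\<close>).  The eigenvalue equation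
  thus reads \<open>\<lambda>\<^sub>3 G\<^sup>3 = E\<close>.  If \<open>\<lambda>\<^sub>3 = 0\<close>, then \<open>E = 0\<close> and both gradients vanish.  Otherwise
  \<open>(G\<^sup>1)\<^sup>2 + (G\<^sup>2)\<^sup>2\<close> is constant, and a sum of two squares of affine functions is constant
  only if both functions are (lemma \<open>constant_affine_squares\<close>).  Either way \<open>E = 0\<close>, so that
  \<open>\<lambda>\<^sub>3 G\<^sup>3 = 0\<close> with \<open>G\<^sup>3 \<noteq> 0\<close> at some point forces \<open>\<lambda>\<^sub>3 = 0\<close>.  The
  \<open>t\<close>-coefficients of \<open>G\<^sup>1\<close> and \<open>G\<^sup>2\<close> are \<open>- c\<^sub>1\<close> and \<open>- c\<^sub>2\<close>, and the \<open>u\<close>-coefficient of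
  \<open>G\<^sup>1\<close> is \<open>- z''\<close>; their vanishing is the claim on \<open>c\<^sub>1\<close>, \<open>c\<^sub>2\<close> and \<open>z\<close>.\<close>

text \<open>The relational form of a partial derivative records that the derivative exists, which
  the function \<open>partial\<close> does not; the derivative rules need this.\<close>

definition has_partial :: "2 \<Rightarrow> (real^2 \<Rightarrow> real) \<Rightarrow> real \<Rightarrow> real^2 \<Rightarrow> bool" where
  "has_partial i f d p \<longleftrightarrow> ((\<lambda>s. f (p + s *\<^sub>R axis i 1)) has_real_derivative d) (at 0)"

lemma partial_eqI: "has_partial i f d p \<Longrightarrow> partial i f p = d"
  unfolding has_partial_def partial_def
  by (simp add: vector_derivative_at has_real_derivative_iff_has_vector_derivative)

lemma open_par_rev_domain: "open par_rev_domain"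
  unfolding par_rev_domain_def by (intro open_Collect_less continuous_intros)

text \<open>The Gauss map and the metric are known only on the domain \<open>u > 0\<close>.  Since this set is
  open, it contains a segment around \<open>p\<close> in either coordinate direction, and a partial derivative
  at \<open>p\<close> depends only on the values there.\<close>

lemma has_partial_cong:
  assumes "has_partial i f d p" "p \<in> par_rev_domain"
    and eq: "\<And>q. q \<in> par_rev_domain \<Longrightarrow> f q = g q"
  shows "has_partial i g d p"
proof -
  let ?l = "\<lambda>s. p + s *\<^sub>R axis i 1"
  have "open (?l -` par_rev_domain)"
    by (intro open_vimage open_par_rev_domain continuous_intros)
  then show ?thesis
    unfolding has_partial_def
    by (rule has_field_derivative_transform_within_open[OF assms(1)[unfolded has_partial_def]])
      (use assms(2) in \<open>auto intro: eq\<close>)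
qed

lemma matrix_inv_eqI:
  fixes A B :: "'a::semiring_1^'n^'n"
  assumes AB: "A ** B = mat 1" and BA: "B ** A = mat 1"
  shows "matrix_inv A = B"
  unfolding matrix_inv_def
proof (rule some_equality)
  fix X assume "A ** X = mat 1 \<and> X ** A = mat 1"
  then show "X = B"
    by (metis AB matrix_mul_assoc matrix_mul_lid matrix_mul_rid)
qed (simp add: AB BA)

lemma matrix_inv_par_rev_metric:
  fixes a b :: real
  assumes "b \<noteq> 0"
  shows "matrix_inv (vector [vector [1, a], vector [a, a\<^sup>2 + b\<^sup>2]] :: real^2^2)
    = vector [vector [(a\<^sup>2 + b\<^sup>2) / b\<^sup>2, - a / b\<^sup>2], vector [- a / b\<^sup>2, 1 / b\<^sup>2]]"
  using assms
  by (intro matrix_inv_eqI)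
    (simp_all add: vec_eq_iff forall_2 matrix_matrix_mult_def sum_2 mat_def field_simps
      power2_eq_square)

text \<open>The metric is constant on the domain, so its determinant and inverse pass through the outer
  derivatives and only second derivatives of \<open>f\<close> remain.  The first derivatives \<open>F\<close> are needed on
  the whole domain, the second derivatives \<open>H\<close> only at the point.\<close>

lemma laplace_beltrami_par_rev_surface:
  assumes z: "smooth_on {0<..} z" and b: "b > 0" and p: "p \<in> par_rev_domain"
    and F: "\<And>j q. q \<in> par_rev_domain \<Longrightarrow> has_partial j f (F j q) q"
    and H: "\<And>i j. has_partial i (F j) (H i j) p"
  shows "laplace_beltrami (par_rev_surface a b c c1 c2 z) f p
    = (a\<^sup>2 + b\<^sup>2) / b\<^sup>2 * H 1 1 - a / b\<^sup>2 * (H 1 2 + H 2 1) + 1 / b\<^sup>2 * H 2 2"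
proof -
  define K :: "real^2^2"
    where "K = vector [vector [(a\<^sup>2 + b\<^sup>2) / b\<^sup>2, - a / b\<^sup>2], vector [- a / b\<^sup>2, 1 / b\<^sup>2]]"
  let ?g = "induced_metric (par_rev_surface a b c c1 c2 z)"
  have inv: "matrix_inv (?g q) = K" if "q \<in> par_rev_domain" for q
    using b by (simp add: metric_par_rev_surface[OF z that] matrix_inv_par_rev_metric K_def)
  have vol: "sqrt (det (?g q)) = b" if "q \<in> par_rev_domain" for q
    using b by (simp add: metric_par_rev_surface[OF z that] det_2 flip: power2_eq_square)
  have flux: "partial i (\<lambda>q. sqrt (det (?g q)) * matrix_inv (?g q) $ i $ j * partial j f q) p
      = b * K $ i $ j * H i j" for i j
  proof (rule partial_eqI, rule has_partial_cong[OF _ p])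
    show "has_partial i (\<lambda>q. b * K $ i $ j * F j q) (b * K $ i $ j * H i j) p"
      using H[of i j] unfolding has_partial_def by (auto intro!: derivative_eq_intros)
    show "b * K $ i $ j * F j q = sqrt (det (?g q)) * matrix_inv (?g q) $ i $ j * partial j f q"
      if "q \<in> par_rev_domain" for q
      using that by (simp add: inv vol partial_eqI[OF F])
  qed
  show ?thesis
    using b unfolding laplace_beltrami_def flux vol[OF p]
    by (simp add: sum_2 K_def field_simps)
qed

lemma smooth_on_derivative: "smooth_on S f \<Longrightarrow> smooth_on S (deriv f)"
  unfolding smooth_on_def by (metis funpow_Suc_right o_apply)

text \<open>The first component of the Gauss map splits as a function of \<open>t\<close> alone, which is linear, plus
  \<open>- z'(u)\<close>; so only the \<open>\<partial>\<^sub>u\<partial>\<^sub>u\<close> term of \<open>\<Delta>\<close> contributes, with a positive coefficient.\<close>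

lemma third_derivative_zero:
  assumes z: "smooth_on {0<..} z" and b: "b > 0" and u: "u > 0"
    and eig: "eigen_eq_on par_rev_domain (par_rev_surface a b c c1 c2 z)
      (\<lambda>p. parabolic_gauss_map (par_rev_surface a b c c1 c2 z) p $ 1) 0"
  shows "deriv (deriv (deriv z)) u = 0"
proof -
  let ?P = "par_rev_surface a b c c1 c2 z"
  let ?G = "\<lambda>p. parabolic_gauss_map ?P p $ 1"
  let ?p = "vector [u, 0] :: real^2"
  have p: "?p \<in> par_rev_domain" using u by (simp add: par_rev_domain_def)
  have z1: "smooth_on {0<..} (deriv z)" and z2: "smooth_on {0<..} (deriv (deriv z))"
    using z by (auto intro: smooth_on_derivative)
  define F :: "2 \<Rightarrow> real^2 \<Rightarrow> real"
    where "F = (\<lambda>j q. if j = 1 then - deriv (deriv z) (q $ 1) else - c1)"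
  define H :: "2 \<Rightarrow> 2 \<Rightarrow> real"
    where "H = (\<lambda>i j. if i = 1 \<and> j = 1 then - deriv (deriv (deriv z)) u else 0)"
  have shift: "((\<lambda>s. f (v + s)) has_real_derivative deriv f v) (at 0)"
    if "smooth_on {0<..} f" "v > 0" for f v
    using smooth_on_deriv[OF that(1), of v] that(2) DERIV_shift[of f "deriv f v" 0 v]
    by (simp add: add.commute)
  have F: "has_partial j ?G (F j q) q" if q: "q \<in> par_rev_domain" for j q
  proof (rule has_partial_cong[OF _ q])
    have q1: "q $ 1 > 0" using q by (simp add: par_rev_domain_def)
    show "has_partial j (\<lambda>p. - c1 * p $ 2 - deriv z (p $ 1)) (F j q) q"
      using exhaust_2[of j] unfolding has_partial_def F_def
      by (auto simp: axis_def intro!: derivative_eq_intros shift[OF z1 q1])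
  qed (simp add: parabolic_gauss_map_par_rev_surface[OF z b] Let_def)
  have H: "has_partial i (F j) (H i j) ?p" for i j
    using exhaust_2[of i] exhaust_2[of j] unfolding has_partial_def F_def H_def
    by (auto simp: axis_def intro!: derivative_eq_intros shift[OF z2 u])
  have "laplace_beltrami ?P ?G ?p = 0"
    using eig p by (simp add: eigen_eq_on_def)
  moreover have "laplace_beltrami ?P ?G ?p
      = (a\<^sup>2 + b\<^sup>2) / b\<^sup>2 * H 1 1 - a / b\<^sup>2 * (H 1 2 + H 2 1) + 1 / b\<^sup>2 * H 2 2"
    by (rule laplace_beltrami_par_rev_surface[OF z b p F H])
  ultimately have "(a\<^sup>2 + b\<^sup>2) / b\<^sup>2 * deriv (deriv (deriv z)) u = 0"
    by (simp add: H_def)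
  moreover have "a\<^sup>2 + b\<^sup>2 > 0" using b by (simp add: sum_power2_gt_zero_iff)
  ultimately show ?thesis using b by auto
qed

lemma affine_if_constant_derivative:
  fixes f :: "real \<Rightarrow> real"
  assumes "\<And>u. u > 0 \<Longrightarrow> (f has_real_derivative q) (at u)"
  shows "\<exists>p. \<forall>u>0. f u = p + q * u"
proof -
  have "\<exists>k. \<forall>u\<in>{0<..}. f u - q * u = k"
  proof (rule has_field_derivative_zero_constant)
    show "((\<lambda>u. f u - q * u) has_field_derivative 0) (at u within {0<..})" if "u \<in> {0<..}" for u
      by (rule has_field_derivative_at_within) (use that in \<open>auto intro!: derivative_eq_intros assms\<close>)
  qed simp
  then obtain k where k: "\<forall>u\<in>{0<..}. f u - q * u = k" ..
  have "f u = k + q * u" if "u > 0" for u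
    using bspec[OF k, of u] that by (simp add: diff_eq_eq)
  then show ?thesis by blast
qed

text \<open>The right-hand side is the sum of the squared lengths of the two affine functions' gradients
  in the induced metric: an orthonormal frame of this metric is \<open>\<partial>\<^sub>u\<close> and
  \<open>(\<partial>\<^sub>t - a \<partial>\<^sub>u) / b\<close>.  Written in this frame, it is visibly a sum of squares that vanishes only
  if \<open>B\<close>, \<open>C\<close>, \<open>B'\<close>, \<open>C'\<close> do.\<close>

lemma laplace_beltrami_affine_squares:
  assumes z: "smooth_on {0<..} z" and b: "b > 0" and p: "p \<in> par_rev_domain"
    and f: "\<And>q. q \<in> par_rev_domain \<Longrightarrow> f q = 1/2 - 1/2 * ((A + B * q $ 1 + C * q $ 2)\<^sup>2
      + (A' + B' * q $ 1 + C' * q $ 2)\<^sup>2)"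
  shows "- laplace_beltrami (par_rev_surface a b c c1 c2 z) f p
    = B\<^sup>2 + ((C - a * B) / b)\<^sup>2 + B'\<^sup>2 + ((C' - a * B') / b)\<^sup>2"
proof -
  define D where "D = (\<lambda>j::2. if j = 1 then B else C)"
  define D' where "D' = (\<lambda>j::2. if j = 1 then B' else C')"
  define F where "F = (\<lambda>j (q::real^2). - (A + B * q $ 1 + C * q $ 2) * D j
      - (A' + B' * q $ 1 + C' * q $ 2) * D' j)"
  define H where "H = (\<lambda>i j. - D i * D j - D' i * D' j)"
  have F: "has_partial j f (F j q) q" if q: "q \<in> par_rev_domain" for j q
  proof (rule has_partial_cong[OF _ q f[symmetric]])
    show "has_partial j (\<lambda>q. 1/2 - 1/2 * ((A + B * q $ 1 + C * q $ 2)\<^sup>2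
        + (A' + B' * q $ 1 + C' * q $ 2)\<^sup>2)) (F j q) q"
      using exhaust_2[of j] unfolding has_partial_def F_def D_def D'_def
      by (auto simp: axis_def algebra_simps add_divide_distrib intro!: derivative_eq_intros)
  qed
  have H: "has_partial i (F j) (H i j) p" for i j
    using exhaust_2[of i] unfolding has_partial_def F_def H_def D_def D'_def
    by (auto simp: axis_def algebra_simps intro!: derivative_eq_intros)
  have "laplace_beltrami (par_rev_surface a b c c1 c2 z) f p
      = (a\<^sup>2 + b\<^sup>2) / b\<^sup>2 * H 1 1 - a / b\<^sup>2 * (H 1 2 + H 2 1) + 1 / b\<^sup>2 * H 2 2"
    by (rule laplace_beltrami_par_rev_surface[OF z b p F H])
  also have "\<dots> = - (B\<^sup>2 + ((C - a * B) / b)\<^sup>2 + B'\<^sup>2 + ((C' - a * B') / b)\<^sup>2)"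
    using b by (simp add: H_def D_def D'_def field_simps power2_eq_square)
  finally show ?thesis by simp
qed

text \<open>Second differences of the sum in the directions of \<open>t\<close> and \<open>u\<close> isolate the leading
  coefficients \<open>C\<^sup>2 + C'\<^sup>2\<close> and \<open>B\<^sup>2 + B'\<^sup>2\<close>.\<close>

lemma constant_affine_squares:
  fixes A B C A' B' C' k :: real
  assumes "\<And>u t. u > 0 \<Longrightarrow> (A + B * u + C * t)\<^sup>2 + (A' + B' * u + C' * t)\<^sup>2 = k"
  shows "B = 0 \<and> C = 0 \<and> B' = 0 \<and> C' = 0"
proof -
  define Q where "Q = (\<lambda>u t. (A + B * u + C * t)\<^sup>2 + (A' + B' * u + C' * t)\<^sup>2)"
  have Q: "Q u t = k" if "u > 0" for u t
    using assms[OF that] by (simp add: Q_def)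
  \<comment> \<open>All nodes have \<open>u \<ge> 1\<close> because the hypothesis covers \<open>u > 0\<close> only.\<close>
  have "C\<^sup>2 + C'\<^sup>2 = (Q 1 1 - 2 * Q 1 0 + Q 1 (- 1)) / 2"
    by (simp add: Q_def power2_eq_square algebra_simps)
  also have "\<dots> = 0" by (simp add: Q)
  finally have "C = 0 \<and> C' = 0" by (simp add: sum_power2_eq_zero_iff)
  moreover have "B\<^sup>2 + B'\<^sup>2 = (Q 3 0 - 2 * Q 2 0 + Q 1 0) / 2"
    by (simp add: Q_def power2_eq_square algebra_simps)
  then have "B\<^sup>2 + B'\<^sup>2 = 0" by (simp add: Q)
  then have "B = 0 \<and> B' = 0" by (simp add: sum_power2_eq_zero_iff)
  ultimately show ?thesis by simp
qed

theorem theorem5p2: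
  fixes a b c c1 c2 lambda3 :: real and z :: "real \<Rightarrow> real"
    and P :: "real^2 \<Rightarrow> real^3"
  assumes "b > 0"
    and "P = par_rev_surface a b c c1 c2 z"
    and "smooth_on {0<..} z"
    and "top_view_finite_type par_rev_domain P 0 0"
    and "\<exists>p\<in>par_rev_domain. parabolic_gauss_map P p $ 3 \<noteq> 0"
    and "eigen_eq_on par_rev_domain P (\<lambda>p. parabolic_gauss_map P p $ 3) lambda3"
  shows "lambda3 = 0 \<and> c1 = 0 \<and> c2 = 0 \<and> (\<exists>z0 z1. \<forall>u>0. z u = z0 + z1 * u)"
proof -
  note b = assms(1) and P = assms(2) and z = assms(3)
  have z1: "smooth_on {0<..} (deriv z)" and z2: "smooth_on {0<..} (deriv (deriv z))"
    using z by (auto intro: smooth_on_derivative)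
  have "(deriv (deriv z) has_real_derivative 0) (at u)" if "u > 0" for u
    using smooth_on_deriv[OF z2, of u] third_derivative_zero[OF z b that, of a c c1 c2] that assms(4)
    unfolding top_view_finite_type_def P by simp
  then obtain q where q: "\<And>u. u > 0 \<Longrightarrow> deriv (deriv z) u = q"
    using affine_if_constant_derivative[of "deriv (deriv z)" 0] by auto
  have "(deriv z has_real_derivative q) (at u)" if "u > 0" for u
    using smooth_on_deriv[OF z1, of u] q that by simp
  then obtain v where v: "\<And>u. u > 0 \<Longrightarrow> deriv z u = v + q * u"
    using affine_if_constant_derivative[of "deriv z" q] by blast
  let ?G3 = "\<lambda>p. parabolic_gauss_map P p $ 3"
  \<comment> \<open>The coefficients of \<open>G\<^sup>1 = A + B u + C t\<close> and \<open>G\<^sup>2 = A' + B' u + C' t\<close>, with the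
    derivative of \<open>z\<close> equal to \<open>v + q u\<close>.\<close>
  define A B C A' B' C' where "A = - v" "B = - q" "C = - c1"
    and "A' = (a * v - c) / b" "B' = (a * q - c1) / b" "C' = - c2"
  note coeffs = this
  have G3: "?G3 p = 1/2 - 1/2 * ((A + B * p $ 1 + C * p $ 2)\<^sup>2 + (A' + B' * p $ 1 + C' * p $ 2)\<^sup>2)"
    if p: "p \<in> par_rev_domain" for p
  proof -
    have "p $ 1 > 0" using p by (simp add: par_rev_domain_def)
    moreover have "- c1 * p $ 2 - (v + q * p $ 1) = A + B * p $ 1 + C * p $ 2"
      by (simp add: coeffs)
    moreover have "(a * (v + q * p $ 1) - c - b * c2 * p $ 2 - c1 * p $ 1) / b
        = A' + B' * p $ 1 + C' * p $ 2"
      using b by (simp add: coeffs field_simps)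
    ultimately show ?thesis
      by (simp only: P parabolic_gauss_map_par_rev_surface[OF z b p] Let_def v vector_3)
  qed
  define E where "E = B\<^sup>2 + ((C - a * B) / b)\<^sup>2 + B'\<^sup>2 + ((C' - a * B') / b)\<^sup>2"
  have eig: "lambda3 * ?G3 p = E" if p: "p \<in> par_rev_domain" for p
    using laplace_beltrami_affine_squares[OF z b p G3, of a c c1 c2] assms(6) p
    unfolding E_def by (simp add: eigen_eq_on_def P)
  have flat: "B = 0 \<and> C = 0 \<and> B' = 0 \<and> C' = 0"
  proof (cases "lambda3 = 0")
    case True
    obtain p where "p \<in> par_rev_domain" using assms(5) by blast
    from eig[OF this] True have "E = 0" by simp
    then show ?thesis
      using b unfolding E_def by (auto simp: add_nonneg_eq_0_iff)
  next
    case False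
    show ?thesis
    proof (rule constant_affine_squares)
      fix u t :: real assume "u > 0"
      then have "vector [u, t] \<in> par_rev_domain" by (simp add: par_rev_domain_def)
      from eig[OF this] G3[OF this] False
      show "(A + B * u + C * t)\<^sup>2 + (A' + B' * u + C' * t)\<^sup>2 = 1 - 2 * (E / lambda3)"
        by (simp add: field_simps)
    qed
  qed
  then have "E = 0" by (simp add: E_def)
  with eig assms(5) have "lambda3 = 0" by auto
  moreover have "q = 0" "c1 = 0" "c2 = 0" using flat by (simp_all add: coeffs)
  moreover have "\<exists>z0 z1. \<forall>u>0. z u = z0 + z1 * u"
  proof -
    have "(z has_real_derivative v) (at u)" if "u > 0" for u
      using smooth_on_deriv[OF z, of u] v[OF that] \<open>q = 0\<close> that by simp
    then obtain z0 where "\<And>u. u > 0 \<Longrightarrow> z u = z0 + v * u"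
      using affine_if_constant_derivative[of z v] by blast
    then show ?thesis by blast
  qed
  ultimately show ?thesis by blast
qed

end
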